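(* Let $\Gamma=(V,\rho,a,B)$ be a finite network with edge parameters $R_{xy},L_{xy},D_{xy}$. If $\operatorname{Re}\lambda>0$ then $$|\mathcal{P}(\lambda)|\le C\,\frac{|\lambda|^{2}\left(1+|\lambda|^{2}\right)}{(\operatorname{Re}\lambda)^{3}},\qquad\text{where}\qquad C=\sum_{x\sim a}\frac{1}{R_{xa}+L_{xa}+D_{xa}}.$$
   Context: Let $(V,E)$ be a finite connected undirected graph with $|V|\ge2$, edges being unordered pairs $xy$ of vertices; $x\sim y$ means $xy\in E$. Each edge $xy\in E$ carries real numbers $R_{xy},L_{xy},D_{xy}\in[0,+\infty)$ with $R_{xy}+L_{xy}+D_{xy}>0$. For $\lambda\in\mathbb{C}\setminus\{0\}$ put $z_{xy}^{(\lambda)}=R_{xy}+L_{xy}\lambda+\frac{D_{xy}}{\lambda}$ (impedance) and $\rho_{xy}^{(\lambda)}=1/z_{xy}^{(\lambda)}$ (admittance); set $\rho_{xy}^{(\lambda)}=0$ if $x\not\sim y$. Let $\Lambda$ be the set of those $\lambda\in\mathbb{C}\setminus\{0\}$ with $L_{xy}\lambda^2+R_{xy}\lambda+D_{xy}\ne0$ for all $xy\in E$; $\Lambda\supset\{\operatorname{Re}\lambda>0\}$. Fix $a\in V$ and a non-empty $B\subset V$ with $a\notin B$; put $B_0=B\cup\{a\}$. The structure $\Gamma=(V,\rho,a,B)$ is called a finite network. For $\lambda\in\Lambda$ and $f:V\to\mathbb{C}$ put $\Delta_\rho f(x)=\sum_{y\in V}(f(y)-f(x))\rho_{xy}^{(\lambda)}$.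 The Dirichlet problem for $v:V\to\mathbb{C}$ is: $\Delta_\rho v(x)=0$ for $x\in V\setminus B_0$, $v(x)=0$ for $x\in B$, $v(a)=1$. The effective admittance of $\Gamma$ is $\mathcal{P}(\lambda)=\sum_{x\in V}(1-v(x))\rho_{xa}^{(\lambda)}$ where $v$ is any solution of the Dirichlet problem (the value does not depend on the choice of the solution); if there is no solution, $\mathcal{P}(\lambda)=\infty$. *)

theory Defs
  imports "HOL-Analysis.Analysis"
begin

(* An edge between x and y is the set {x, y}; edge parameters are functions of this set and are
   therefore symmetric. Loops {x, x} = {x} are not excluded: they drop out of the Laplacian. *)
locale finite_network =
  fixes V :: "'v set" and E :: "'v set set"
    and R L D :: "'v set \<Rightarrow> real"
    and a :: 'v and B :: "'v set"
  assumes finite_V: "finite V"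
    and card_V: "card V \<ge> 2"
    and edges: "E \<subseteq> {{x, y} | x y. x \<in> V \<and> y \<in> V}"
    and connected: "\<And>x y. x \<in> V \<Longrightarrow> y \<in> V \<Longrightarrow> (x, y) \<in> {(u, w). {u, w} \<in> E}\<^sup>*"
    and R_nonneg: "\<And>e. e \<in> E \<Longrightarrow> R e \<ge> 0"
    and L_nonneg: "\<And>e. e \<in> E \<Longrightarrow> L e \<ge> 0"
    and D_nonneg: "\<And>e. e \<in> E \<Longrightarrow> D e \<ge> 0"
    and RLD_pos: "\<And>e. e \<in> E \<Longrightarrow> R e + L e + D e > 0"
    and a_in_V: "a \<in> V"
    and B_subset: "B \<subseteq> V"
    and B_nonempty: "B \<noteq> {}"
    and a_notin_B: "a \<notin> B"

(* The complex frequency is written s. *)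
definition impedance ::
    "('v set \<Rightarrow> real) \<Rightarrow> ('v set \<Rightarrow> real) \<Rightarrow> ('v set \<Rightarrow> real) \<Rightarrow> complex \<Rightarrow> 'v set \<Rightarrow> complex" where
  "impedance R L D s e = of_real (R e) + of_real (L e) * s + of_real (D e) / s"

definition admittance ::
    "'v set set \<Rightarrow> ('v set \<Rightarrow> real) \<Rightarrow> ('v set \<Rightarrow> real) \<Rightarrow> ('v set \<Rightarrow> real) \<Rightarrow>
      complex \<Rightarrow> 'v \<Rightarrow> 'v \<Rightarrow> complex" where
  "admittance E R L D s x y = (if {x, y} \<in> E then 1 / impedance R L D s {x, y} else 0)"

definition laplacian ::
    "'v set \<Rightarrow> ('v \<Rightarrow> 'v \<Rightarrow> complex) \<Rightarrow> ('v \<Rightarrow> complex) \<Rightarrow> 'v \<Rightarrow> complex" where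
  "laplacian V \<rho> f x = (\<Sum>y\<in>V. (f y - f x) * \<rho> x y)"

(* Only the values of v on V matter, here and below. *)
definition dirichlet_solution ::
    "'v set \<Rightarrow> ('v \<Rightarrow> 'v \<Rightarrow> complex) \<Rightarrow> 'v \<Rightarrow> 'v set \<Rightarrow> ('v \<Rightarrow> complex) \<Rightarrow> bool" where
  "dirichlet_solution V \<rho> a B v \<longleftrightarrow>
     (\<forall>x\<in>V - (B \<union> {a}). laplacian V \<rho> v x = 0) \<and> (\<forall>x\<in>B. v x = 0) \<and> v a = 1"

definition current_at ::
    "'v set \<Rightarrow> ('v \<Rightarrow> 'v \<Rightarrow> complex) \<Rightarrow> 'v \<Rightarrow> ('v \<Rightarrow> complex) \<Rightarrow> complex" where
  "current_at V \<rho> a v = (\<Sum>x\<in>V. (1 - v x) * \<rho> x a)"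

datatype ext_complex = Finite complex | Infty

fun ext_cmod :: "ext_complex \<Rightarrow> ereal" where
  "ext_cmod (Finite z) = ereal (cmod z)"
| "ext_cmod Infty = \<infinity>"

(* Independent of the chosen solution: see current_at_unique. *)
definition effective_admittance ::
    "'v set \<Rightarrow> ('v \<Rightarrow> 'v \<Rightarrow> complex) \<Rightarrow> 'v \<Rightarrow> 'v set \<Rightarrow> ext_complex" where
  "effective_admittance V \<rho> a B =
     (if \<exists>v. dirichlet_solution V \<rho> a B v
      then Finite (current_at V \<rho> a (SOME v. dirichlet_solution V \<rho> a B v))
      else Infty)"

lemma admittance_sym: "admittance E R L D s x y = admittance E R L D s y x"
  by (simp add: admittance_def insert_commute)

lemma laplacian_symmetric:
  assumes "\<And>x y. \<rho> x y = \<rho> y x"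
  shows "(\<Sum>x\<in>V. laplacian V \<rho> f x * g x) = (\<Sum>x\<in>V. laplacian V \<rho> g x * f x)"
proof -
  have "(\<Sum>x\<in>V. \<Sum>y\<in>V. f y * g x * \<rho> x y) = (\<Sum>x\<in>V. \<Sum>y\<in>V. f x * g y * \<rho> x y)"
    by (subst sum.swap) (simp add: assms)
  then show ?thesis
    by (simp add: laplacian_def sum_distrib_left sum_distrib_right algebra_simps sum_subtractf)
qed

lemma current_at_unique:
  assumes "finite V" "a \<in> V" "B \<subseteq> V" "a \<notin> B"
    and sym: "\<And>x y. \<rho> x y = \<rho> y x"
    and u: "dirichlet_solution V \<rho> a B u" and v: "dirichlet_solution V \<rho> a B v"
  shows "current_at V \<rho> a u = current_at V \<rho> a v"
proof -
  have *: "(\<Sum>x\<in>V. laplacian V \<rho> f x * g x) = - current_at V \<rho> a f"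
    if f: "dirichlet_solution V \<rho> a B f" and g: "dirichlet_solution V \<rho> a B g" for f g
  proof -
    have "(\<Sum>x\<in>V. laplacian V \<rho> f x * g x) = (\<Sum>x\<in>{a}. laplacian V \<rho> f x * g x)"
      using assms(1,2) f g by (intro sum.mono_neutral_right) (auto simp: dirichlet_solution_def)
    also have "\<dots> = laplacian V \<rho> f a"
      using g by (simp add: dirichlet_solution_def)
    also have "\<dots> = (\<Sum>x\<in>V. - ((1 - f x) * \<rho> x a))"
      using f sym[of a] by (simp add: laplacian_def dirichlet_solution_def algebra_simps)
    finally show ?thesis
      by (simp add: current_at_def sum_negf)
  qed
  show ?thesis
    using *[OF u v] *[OF v u] laplacian_symmetric[of \<rho> V u v, OF sym] by simp
qed

(* On the right half-plane no impedance of an edge vanishes, so that 1 / 0 = 0 is never used. *)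
lemma (in finite_network) impedance_nonzero:
  assumes "Re s > 0" "e \<in> E"
  shows "impedance R L D s e \<noteq> 0"
proof -
  have r: "Re (1 / s) > 0"
    using assms(1) by (auto simp: Re_divide intro!: divide_pos_pos add_pos_nonneg)
  have "Re (impedance R L D s e) = R e + L e * Re s + D e * Re (1 / s)"
    by (simp add: impedance_def Re_divide)
  also have "\<dots> > 0"
    using R_nonneg[OF assms(2)] L_nonneg[OF assms(2)] D_nonneg[OF assms(2)] RLD_pos[OF assms(2)]
      assms(1) r
    by (smt (verit) mult_nonneg_nonneg mult_pos_pos)
  finally show ?thesis by auto
qed

end

theory Submission
  imports Defs
begin

text \<open>
  For \<open>Re s > 0\<close> every impedance \<open>z\<close> has positive real part, hence so has the admittance
  \<open>\<rho> = 1 / z\<close>; the network strictly dissipates power. Green's identity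
  turns this into the two facts on which everything rests.

  The first is solvability. A function that is harmonic wherever it does not vanish, and
  vanishes at one vertex, dissipates no power, so it is constant along edges and zero by
  connectedness (\<open>harmonic_or_zero_imp_zero\<close>). Uniqueness in this form, for every choice of the
  set of interior vertices, lets interior vertices be added one at a time
  (\<open>dirichlet_problem_solvable\<close>). Hence the effective admittance is finite.

  The second is the bound. For a solution \<open>v\<close>, the effective admittance \<open>P\<close> is the total complex
  power, the sum of \<open>\<bar>v x - v y\<bar>\<^sup>2 \<rho> x y\<close> over the edges. The edges at \<open>a\<close> dissipate only part of
  it, so their contribution to \<open>Re P\<close> is at most \<open>\<bar>P\<bar>\<close>. On the other hand, \<open>P\<close> is the current
  leaving \<open>a\<close>, the sum of \<open>(1 - v x) \<rho> x a\<close>, and the Cauchy--Schwarz inequality with weights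
  \<open>Re \<rho>\<close> gives \<open>\<bar>P\<bar>\<^sup>2 \<le> \<bar>P\<bar> \<Sum> \<bar>\<rho>\<bar>\<^sup>2 / Re \<rho>\<close>. Since \<open>\<bar>\<rho>\<bar>\<^sup>2 / Re \<rho> = 1 / Re z\<close>, this means
  \<open>\<bar>P\<bar> \<le> \<Sum> 1 / Re z\<close>, summed over the edges at \<open>a\<close>, and it remains to bound
  \<open>Re z = R + L Re s + D Re s / \<bar>s\<bar>\<^sup>2\<close> from below by a multiple of \<open>R + L + D\<close>.
\<close>

section \<open>Green's identity and dissipated power\<close>

lemma green_identity:
  assumes sym: "\<And>x y. \<rho> x y = \<rho> y x"
  shows "2 * (\<Sum>x\<in>V. laplacian V \<rho> f x * g x)
    = - (\<Sum>x\<in>V. \<Sum>y\<in>V. (f y - f x) * (g y - g x) * \<rho> x y)"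
proof -
  have "(\<Sum>x\<in>V. laplacian V \<rho> f x * g x) = (\<Sum>x\<in>V. \<Sum>y\<in>V. (f y - f x) * \<rho> x y * g x)"
    by (simp add: laplacian_def sum_distrib_right)
  moreover have "\<dots> = (\<Sum>x\<in>V. \<Sum>y\<in>V. (f x - f y) * \<rho> x y * g y)"
    by (subst sum.swap) (simp add: sym)
  ultimately have "2 * (\<Sum>x\<in>V. laplacian V \<rho> f x * g x)
    = (\<Sum>x\<in>V. \<Sum>y\<in>V. (f y - f x) * \<rho> x y * g x) + (\<Sum>x\<in>V. \<Sum>y\<in>V. (f x - f y) * \<rho> x y * g y)"
    by simp
  also have "\<dots> = (\<Sum>x\<in>V. \<Sum>y\<in>V. - ((f y - f x) * (g y - g x) * \<rho> x y))"
    unfolding sum.distrib[symmetric] by (intro sum.cong refl) (simp add: algebra_simps)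
  finally show ?thesis
    by (simp add: sum_negf)
qed

text \<open>Testing Green's identity with the complex conjugate of \<open>f\<close> makes the squared potential
  differences real, so that only the real parts of the admittances remain.\<close>

lemma dissipated_power:
  assumes sym: "\<And>x y. \<rho> x y = \<rho> y x"
  shows "(\<Sum>x\<in>V. \<Sum>y\<in>V. (cmod (f y - f x))\<^sup>2 * Re (\<rho> x y))
    = - 2 * Re (\<Sum>x\<in>V. laplacian V \<rho> f x * cnj (f x))"
proof -
  have sq: "Re ((f y - f x) * (cnj (f y) - cnj (f x)) * \<rho> x y)
      = (cmod (f y - f x))\<^sup>2 * Re (\<rho> x y)" for x y
  proof -
    have "(f y - f x) * (cnj (f y) - cnj (f x)) = of_real ((cmod (f y - f x))\<^sup>2)"
      by (metis complex_cnj_diff complex_norm_square)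
    then show ?thesis
      by (metis Re_complex_of_real Im_complex_of_real diff_zero mult_zero_left times_complex.sel(1))
  qed
  have "2 * Re (\<Sum>x\<in>V. laplacian V \<rho> f x * cnj (f x))
      = Re (2 * (\<Sum>x\<in>V. laplacian V \<rho> f x * cnj (f x)))"
    by simp
  also have "\<dots> = - (\<Sum>x\<in>V. \<Sum>y\<in>V. Re ((f y - f x) * (cnj (f y) - cnj (f x)) * \<rho> x y))"
    by (simp only: green_identity[OF sym] uminus_complex.sel Re_sum)
  finally show ?thesis
    by (simp only: sq)
qed

text \<open>The edges at \<open>a\<close> occur in the double sum of \<open>dissipated_power\<close> twice, once as row and once as
  column, which cancels the factor 2.\<close>

lemma power_at_source_le:
  assumes "finite V" "a \<in> V"
    and sym: "\<And>x y. \<rho> x y = \<rho> y x"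
    and nonneg: "\<And>x y. Re (\<rho> x y) \<ge> 0"
    and v: "dirichlet_solution V \<rho> a B v"
  shows "(\<Sum>x\<in>V. (cmod (1 - v x))\<^sup>2 * Re (\<rho> x a)) \<le> Re (current_at V \<rho> a v)"
proof -
  define p where "p x y = (cmod (v y - v x))\<^sup>2 * Re (\<rho> x y)" for x y
  have p_nonneg: "p x y \<ge> 0" and p_sym: "p x y = p y x" and p_diag: "p x x = 0" for x y
    using nonneg[of x y] by (simp_all add: p_def sym[of x y] norm_minus_commute)
  have va: "v a = 1"
    using v by (simp add: dirichlet_solution_def)
  have "(\<Sum>x\<in>V. laplacian V \<rho> v x * cnj (v x)) = (\<Sum>x\<in>{a}. laplacian V \<rho> v x * cnj (v x))"
    using assms(1,2) v by (intro sum.mono_neutral_right) (auto simp: dirichlet_solution_def)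
  also have "\<dots> = - current_at V \<rho> a v"
    unfolding current_at_def sum_negf[symmetric]
    by (simp add: va laplacian_def sym[of a] algebra_simps)
  finally have "(\<Sum>x\<in>V. \<Sum>y\<in>V. p x y) = 2 * Re (current_at V \<rho> a v)"
    using dissipated_power[where \<rho> = \<rho> and V = V and f = v, OF sym] by (simp add: p_def)
  moreover have "2 * (\<Sum>x\<in>V. p x a) \<le> (\<Sum>x\<in>V. \<Sum>y\<in>V. p x y)"
  proof -
    have "(\<Sum>x\<in>V. p x a) = (\<Sum>x\<in>V - {a}. p x a)"
      using assms(1,2) by (simp add: sum.remove[of V a] p_diag)
    also have "\<dots> \<le> (\<Sum>x\<in>V - {a}. \<Sum>y\<in>V. p x y)"
      using assms(1,2) p_nonneg by (intro sum_mono member_le_sum) auto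
    finally show ?thesis
      using assms(1,2) p_sym by (simp add: sum.remove[of V a "\<lambda>x. \<Sum>y\<in>V. p x y"] p_sym[of a])
  qed
  ultimately show ?thesis
    by (simp add: p_def va)
qed

section \<open>Solvability of the Dirichlet problem\<close>

text \<open>With zero boundary data the Dirichlet problem has only the zero solution, whatever
  the interior is, because harmonicity is required only where \<open>u\<close> does not vanish.\<close>

lemma harmonic_or_zero_imp_zero:
  assumes "finite V" "a \<in> V"
    and sym: "\<And>x y. \<rho> x y = \<rho> y x"
    and nonneg: "\<And>x y. Re (\<rho> x y) \<ge> 0"
    and connected: "\<And>x. x \<in> V \<Longrightarrow> (a, x) \<in> {(u, w). u \<in> V \<and> w \<in> V \<and> Re (\<rho> u w) > 0}\<^sup>*"
    and ua: "u a = 0"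
    and harmonic: "\<And>x. x \<in> V \<Longrightarrow> u x = 0 \<or> laplacian V \<rho> u x = 0"
    and "x \<in> V"
  shows "u x = 0"
proof -
  have "(\<Sum>x\<in>V. laplacian V \<rho> u x * cnj (u x)) = 0"
    using harmonic by (intro sum.neutral) auto
  then have power0: "(\<Sum>x\<in>V. \<Sum>y\<in>V. (cmod (u y - u x))\<^sup>2 * Re (\<rho> x y)) = 0"
    using dissipated_power[where \<rho> = \<rho> and V = V and f = u, OF sym] by simp
  have edge: "u y = u x" if "x \<in> V" "y \<in> V" "Re (\<rho> x y) > 0" for x y
  proof -
    have "(\<Sum>y\<in>V. (cmod (u y - u x))\<^sup>2 * Re (\<rho> x y)) = 0"
      using power0 that(1) assms(1) nonneg
      by (subst (asm) sum_nonneg_eq_0_iff) (auto intro!: sum_nonneg)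
    then have "(cmod (u y - u x))\<^sup>2 * Re (\<rho> x y) = 0"
      using that(2) assms(1) nonneg by (subst (asm) sum_nonneg_eq_0_iff) auto
    then show ?thesis
      using that(3) by simp
  qed
  show ?thesis
    using connected[OF \<open>x \<in> V\<close>] by (induction rule: rtrancl_induct) (use ua edge in auto)
qed

text \<open>When a vertex \<open>w\<close> joins the interior, the solution for the smaller interior is corrected by a
  multiple of the solution \<open>g\<close> that is 1 at \<open>w\<close> and 0 on the rest of the boundary. The multiple
  exists because the Laplacian of \<open>g\<close> cannot vanish at \<open>w\<close>: otherwise \<open>g\<close> would be
  harmonic wherever it does not vanish, hence zero.\<close>

lemma dirichlet_problem_solvable:
  assumes "finite V" "a \<in> V"
    and sym: "\<And>x y. \<rho> x y = \<rho> y x"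
    and nonneg: "\<And>x y. Re (\<rho> x y) \<ge> 0"
    and connected: "\<And>x. x \<in> V \<Longrightarrow> (a, x) \<in> {(u, w). u \<in> V \<and> w \<in> V \<and> Re (\<rho> u w) > 0}\<^sup>*"
    and "U \<subseteq> V - {a}"
  shows "\<exists>v. (\<forall>x\<in>U. laplacian V \<rho> v x = 0) \<and> (\<forall>x\<in>V - U. v x = f x)"
proof -
  have "finite U"
    using assms(1,6) by (meson finite_Diff finite_subset)
  then show ?thesis
    using \<open>U \<subseteq> V - {a}\<close>
  proof (induction U arbitrary: f rule: finite_induct)
    case empty
    then show ?case by auto
  next
    case (insert w U)
    then have w: "w \<in> V" "w \<noteq> a" "w \<notin> U" and U: "U \<subseteq> V - {a}"
      by auto
    obtain h where h: "\<forall>x\<in>U. laplacian V \<rho> h x = 0" "\<forall>x\<in>V - U. h x = f x"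
      using insert.IH[OF U] by blast
    obtain g where g: "\<forall>x\<in>U. laplacian V \<rho> g x = 0" "\<forall>x\<in>V - U. g x = (if x = w then 1 else 0)"
      using insert.IH[OF U, of "\<lambda>x. if x = w then 1 else 0"] by blast
    have "laplacian V \<rho> g w \<noteq> 0"
    proof
      assume gw: "laplacian V \<rho> g w = 0"
      have "a \<in> V - U"
        using \<open>a \<in> V\<close> U by blast
      then have "g a = 0"
        using g(2) w(2) by simp
      moreover have "g x = 0 \<or> laplacian V \<rho> g x = 0" if "x \<in> V" for x
        using that g gw by (cases "x = w") auto
      ultimately have "g w = 0"
        using harmonic_or_zero_imp_zero[where u = g, OF assms(1,2) sym nonneg connected] w(1)
        by blast
      then show False
        using g(2) w by simp
    qed
    define c where "c = - laplacian V \<rho> h w / laplacian V \<rho> g w"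
    have lin: "laplacian V \<rho> (\<lambda>x. h x + c * g x) x = laplacian V \<rho> h x + c * laplacian V \<rho> g x" for x
      unfolding laplacian_def sum_distrib_left sum.distrib[symmetric]
      by (intro sum.cong refl) (simp add: algebra_simps)
    have "\<forall>x\<in>insert w U. laplacian V \<rho> (\<lambda>x. h x + c * g x) x = 0"
      using h(1) g(1) \<open>laplacian V \<rho> g w \<noteq> 0\<close> by (auto simp: lin) (simp add: c_def)
    moreover have "\<forall>x\<in>V - insert w U. h x + c * g x = f x"
      using h(2) g(2) by auto
    ultimately show ?case by blast
  qed
qed

section \<open>Admittances in the right half-plane\<close>

text \<open>The three coefficients 1, \<open>Re s\<close> and \<open>Re s / \<bar>s\<bar>\<^sup>2\<close> of \<open>R\<close>, \<open>L\<close> and \<open>D\<close> in \<open>Re z\<close> are all at least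
  \<open>Re s / (1 + \<bar>s\<bar>\<^sup>2)\<close>, which in turn is at least the constant in the statement because
  \<open>Re s \<le> \<bar>s\<bar>\<close>.\<close>

lemma (in finite_network) Re_impedance_ge:
  assumes "Re s > 0" "e \<in> E"
  shows "(R e + L e + D e) * ((Re s) ^ 3 / ((cmod s)\<^sup>2 * (1 + (cmod s)\<^sup>2)))
    \<le> Re (impedance R L D s e)"
proof -
  define r t m where "r = Re s" and "t = cmod s" and "m = r / (1 + t\<^sup>2)"
  have r: "0 < r" "r \<le> t"
    using assms(1) complex_Re_le_cmod[of s] by (auto simp: r_def t_def)
  then have t: "0 < t" by simp
  have "r\<^sup>2 \<le> t\<^sup>2"
    using r by (intro power_mono) auto
  have pos: "0 < 1 + t\<^sup>2"
    by (simp add: add_pos_nonneg)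
  have "r ^ 3 / (t\<^sup>2 * (1 + t\<^sup>2)) = m * (r\<^sup>2 / t\<^sup>2)"
    by (simp add: m_def power3_eq_cube power2_eq_square mult.commute)
  also have "\<dots> \<le> m * 1"
    using \<open>r\<^sup>2 \<le> t\<^sup>2\<close> r t pos by (intro mult_left_mono) (auto simp: m_def)
  finally have le_m: "r ^ 3 / (t\<^sup>2 * (1 + t\<^sup>2)) \<le> m" by simp
  have "2 * t \<le> 1 + t\<^sup>2"
    using sum_squares_bound[of t 1] by simp
  then have m1: "m \<le> 1"
    using r t pos by (simp add: m_def)
  have mr: "m \<le> r"
    using r pos by (simp add: m_def divide_le_eq mult_le_cancel_left1)
  have mrt: "m \<le> r / t\<^sup>2"
    using r t pos unfolding m_def by (intro divide_left_mono) auto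
  have "(R e + L e + D e) * (r ^ 3 / (t\<^sup>2 * (1 + t\<^sup>2))) \<le> (R e + L e + D e) * m"
    using le_m RLD_pos[OF assms(2)] by (intro mult_left_mono) auto
  also have "\<dots> = R e * m + L e * m + D e * m"
    by (simp add: algebra_simps)
  also have "\<dots> \<le> R e * 1 + L e * r + D e * (r / t\<^sup>2)"
    using R_nonneg[OF assms(2)] L_nonneg[OF assms(2)] D_nonneg[OF assms(2)] m1 mr mrt
    by (intro add_mono mult_left_mono) auto
  also have "\<dots> = Re (impedance R L D s e)"
    by (simp add: impedance_def Re_divide r_def t_def cmod_power2)
  finally show ?thesis
    by (simp add: r_def t_def)
qed

lemma (in finite_network) Re_impedance_pos:
  assumes "Re s > 0" "e \<in> E"
  shows "Re (impedance R L D s e) > 0"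
proof -
  have "cmod s > 0"
    using assms(1) by auto
  then have "(Re s) ^ 3 / ((cmod s)\<^sup>2 * (1 + (cmod s)\<^sup>2)) > 0"
    using assms(1) by (intro divide_pos_pos mult_pos_pos add_pos_nonneg) auto
  then show ?thesis
    using Re_impedance_ge[OF assms] RLD_pos[OF assms(2)] by (smt (verit) mult_pos_pos)
qed

lemma (in finite_network) Re_admittance:
  "Re (admittance E R L D s x y)
    = (if {x, y} \<in> E then (cmod (admittance E R L D s x y))\<^sup>2 * Re (impedance R L D s {x, y}) else 0)"
  by (simp add: admittance_def Re_divide norm_divide power_divide flip: cmod_power2)

lemma (in finite_network) Re_admittance_pos:
  assumes "Re s > 0" "{x, y} \<in> E"
  shows "Re (admittance E R L D s x y) > 0"
proof -
  have "admittance E R L D s x y \<noteq> 0"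
    using assms(2) impedance_nonzero[OF assms] by (simp add: admittance_def)
  then show ?thesis
    using assms(2) Re_impedance_pos[OF assms] by (simp add: Re_admittance)
qed

lemma (in finite_network) Re_admittance_nonneg:
  assumes "Re s > 0"
  shows "Re (admittance E R L D s x y) \<ge> 0"
proof (cases "{x, y} \<in> E")
  case True
  then show ?thesis
    using Re_admittance_pos[OF assms] by (intro less_imp_le)
qed (simp add: admittance_def)

section \<open>The effective admittance\<close>

lemma (in finite_network) dirichlet_solution_exists:
  assumes "Re s > 0"
  shows "\<exists>v. dirichlet_solution V (admittance E R L D s) a B v"
proof -
  let ?\<rho> = "admittance E R L D s"
  have "{(u, w). {u, w} \<in> E} \<subseteq> {(u, w). u \<in> V \<and> w \<in> V \<and> Re (?\<rho> u w) > 0}"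
    using edges Re_admittance_pos[OF assms] by (auto simp: doubleton_eq_iff)
  then have "(a, x) \<in> {(u, w). u \<in> V \<and> w \<in> V \<and> Re (?\<rho> u w) > 0}\<^sup>*" if "x \<in> V" for x
    using connected[OF a_in_V that] rtrancl_mono by blast
  then have "\<exists>v. (\<forall>x\<in>V - (B \<union> {a}). laplacian V ?\<rho> v x = 0)
      \<and> (\<forall>x\<in>V - (V - (B \<union> {a})). v x = (if x = a then 1 else 0))"
    by (intro dirichlet_problem_solvable[where a = a, OF finite_V a_in_V admittance_sym
        Re_admittance_nonneg[OF assms]]) auto
  then obtain v where "\<forall>x\<in>V - (B \<union> {a}). laplacian V ?\<rho> v x = 0"
      "\<forall>x\<in>V - (V - (B \<union> {a})). v x = (if x = a then 1 else 0)"
    by blast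
  then have "dirichlet_solution V ?\<rho> a B v"
    using B_subset a_in_V a_notin_B by (auto simp: dirichlet_solution_def subset_iff)
  then show ?thesis
    by blast
qed

text \<open>The current at \<open>a\<close> on the left of the Cauchy--Schwarz inequality reappears on the right as a
  bound for the power dissipated at \<open>a\<close>, and cancels.\<close>

lemma (in finite_network) cmod_current_at_le:
  assumes s: "Re s > 0" and v: "dirichlet_solution V (admittance E R L D s) a B v"
  shows "cmod (current_at V (admittance E R L D s) a v)
    \<le> (\<Sum>x\<in>{x\<in>V. {x, a} \<in> E}. 1 / Re (impedance R L D s {x, a}))"
proof -
  define N where "N = {x\<in>V. {x, a} \<in> E}"
  define \<rho> where "\<rho> = admittance E R L D s"
  define z where "z x = Re (impedance R L D s {x, a})" for x
  define P where "P = cmod (current_at V \<rho> a v)"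
  have N: "finite N" "N \<subseteq> V"
    using finite_V by (auto simp: N_def)
  have z: "z x > 0" if "x \<in> N" for x
    using that Re_impedance_pos[OF s] by (simp add: N_def z_def)
  have Re\<rho>: "Re (\<rho> x a) = (cmod (\<rho> x a))\<^sup>2 * z x" if "x \<in> N" for x
    using that by (simp add: \<rho>_def z_def N_def Re_admittance)
  have "current_at V \<rho> a v = (\<Sum>x\<in>N. (1 - v x) * \<rho> x a)"
    unfolding current_at_def
    by (intro sum.mono_neutral_right) (use finite_V in \<open>auto simp: N_def \<rho>_def admittance_def\<close>)
  then have "P \<le> (\<Sum>x\<in>N. cmod (1 - v x) * cmod (\<rho> x a))"
    by (simp add: P_def sum_norm_le norm_mult)
  also have "\<dots> = (\<Sum>x\<in>N. (cmod (1 - v x) * cmod (\<rho> x a) * sqrt (z x)) * (1 / sqrt (z x)))"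
    using z by (intro sum.cong refl) (fastforce simp: less_le)
  finally have "P\<^sup>2 \<le> (\<Sum>x\<in>N. (cmod (1 - v x) * cmod (\<rho> x a) * sqrt (z x)) * (1 / sqrt (z x)))\<^sup>2"
    by (intro power_mono) (auto simp: P_def)
  also have "\<dots> \<le> (\<Sum>x\<in>N. (cmod (1 - v x) * cmod (\<rho> x a) * sqrt (z x))\<^sup>2) * (\<Sum>x\<in>N. (1 / sqrt (z x))\<^sup>2)"
    by (rule Cauchy_Schwarz_ineq_sum)
  also have "\<dots> = (\<Sum>x\<in>N. (cmod (1 - v x))\<^sup>2 * Re (\<rho> x a)) * (\<Sum>x\<in>N. 1 / z x)"
    using z by (simp add: power_mult_distrib power_divide Re\<rho> less_imp_le mult.assoc cong: sum.cong)
  also have "\<dots> \<le> P * (\<Sum>x\<in>N. 1 / z x)"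
  proof (intro mult_right_mono)
    have nonneg: "Re (\<rho> x y) \<ge> 0" for x y
      unfolding \<rho>_def using s by (rule Re_admittance_nonneg)
    have "(\<Sum>x\<in>N. (cmod (1 - v x))\<^sup>2 * Re (\<rho> x a)) \<le> (\<Sum>x\<in>V. (cmod (1 - v x))\<^sup>2 * Re (\<rho> x a))"
      using N finite_V nonneg by (intro sum_mono2) auto
    also have "\<dots> \<le> Re (current_at V \<rho> a v)"
      using finite_V a_in_V nonneg v unfolding \<rho>_def
      by (intro power_at_source_le[where B = B] admittance_sym)
    also have "\<dots> \<le> P"
      unfolding P_def by (rule complex_Re_le_cmod)
    finally show "(\<Sum>x\<in>N. (cmod (1 - v x))\<^sup>2 * Re (\<rho> x a)) \<le> P" .
    show "(\<Sum>x\<in>N. 1 / z x) \<ge> 0"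
      using z by (intro sum_nonneg) (simp add: less_imp_le)
  qed
  finally have "P * P \<le> P * (\<Sum>x\<in>N. 1 / z x)"
    by (simp add: power2_eq_square)
  moreover have "(\<Sum>x\<in>N. 1 / z x) \<ge> 0"
    using z by (intro sum_nonneg) (simp add: less_imp_le)
  moreover have "P \<ge> 0"
    by (simp add: P_def)
  ultimately have "P \<le> (\<Sum>x\<in>N. 1 / z x)"
    by (cases "P = 0") auto
  then show ?thesis
    by (simp add: P_def N_def z_def \<rho>_def)
qed

theorem corollary13:
  fixes V :: "'v set" and E :: "'v set set" and R L D :: "'v set \<Rightarrow> real"
    and a :: 'v and B :: "'v set" and s :: complex
  assumes "finite_network V E R L D a B" and "Re s > 0"
  shows "ext_cmod (effective_admittance V (admittance E R L D s) a B)
    \<le> ereal ((\<Sum>x\<in>{x\<in>V. {x, a} \<in> E}. 1 / (R {x, a} + L {x, a} + D {x, a}))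
        * ((cmod s)\<^sup>2 * (1 + (cmod s)\<^sup>2) / (Re s) ^ 3))"
proof -
  interpret finite_network V E R L D a B by fact
  let ?\<rho> = "admittance E R L D s"
  define k where "k = (Re s) ^ 3 / ((cmod s)\<^sup>2 * (1 + (cmod s)\<^sup>2))"
  have "cmod s > 0"
    using assms(2) by auto
  then have k: "k > 0"
    unfolding k_def using assms(2) by (intro divide_pos_pos mult_pos_pos add_pos_nonneg) auto
  define v where "v = (SOME v. dirichlet_solution V ?\<rho> a B v)"
  have ex: "\<exists>v. dirichlet_solution V ?\<rho> a B v"
    using assms(2) by (rule dirichlet_solution_exists)
  then have v: "dirichlet_solution V ?\<rho> a B v"
    unfolding v_def by (rule someI_ex)
  have "cmod (current_at V ?\<rho> a v)
      \<le> (\<Sum>x\<in>{x\<in>V. {x, a} \<in> E}. 1 / Re (impedance R L D s {x, a}))"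
    using assms(2) v by (rule cmod_current_at_le)
  also have "\<dots> \<le> (\<Sum>x\<in>{x\<in>V. {x, a} \<in> E}. 1 / ((R {x, a} + L {x, a} + D {x, a}) * k))"
    using Re_impedance_ge[OF assms(2)] Re_impedance_pos[OF assms(2)] RLD_pos k
    by (intro sum_mono divide_left_mono) (auto simp: k_def[symmetric])
  also have "\<dots> = (\<Sum>x\<in>{x\<in>V. {x, a} \<in> E}. 1 / (R {x, a} + L {x, a} + D {x, a})) * (1 / k)"
    by (simp add: sum_divide_distrib)
  finally show ?thesis
    using ex by (simp add: effective_admittance_def v_def k_def)
qed

end
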